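(* Let $X_1,X_2,\dots$ be independent, identically distributed Bernoulli random variables with $P(X_k=0)=P(X_k=1)=\frac12$. Let $$S_n=\frac{X_1+\cdots+X_n-\frac n2}{\frac{\sqrt n}{2}}$$ and let $Y$ be an $N(0,1)$ random variable. Then for every continuous function $f:\mathbb{R}\to\mathbb{R}$ that is integrable with respect to the $N(0,1)$ law and satisfies $|f(x)|\le e^{(\frac12-\epsilon)x^2}$ for all $x\in\mathbb{R}$, for some $0<\epsilon<\frac12$, we have $$\lim_{n\to\infty}\mathbb{E}f(S_n)=\mathbb{E}f(Y).$$ *)

theory Defs
  imports "HOL-Probability.Probability"
begin

text \<open>
  The sequence starts at index 1; the value \<open>X 0\<close> is never used. For \<open>n = 0\<close> the
  quotient is \<open>0\<close> by the convention on division by zero, which does not affect limits.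
\<close>

definition S :: "(nat \<Rightarrow> 'a \<Rightarrow> real) \<Rightarrow> nat \<Rightarrow> 'a \<Rightarrow> real" where
  "S X n \<omega> = ((\<Sum>k = 1..n. X k \<omega>) - real n / 2) / (sqrt (real n) / 2)"

end

theory Submission
  imports Defs
begin

text \<open>
  By Hoeffding's lemma the normalized sums satisfy \<open>E (exp (t S\<^sub>n)) \<le> exp (t\<^sup>2 / 2)\<close>. Averaging this
  over \<open>t = sqrt a * Z\<close>, with \<open>Z\<close> standard normal and independent of \<open>S\<^sub>n\<close>, yields
  \<open>E (exp (a S\<^sub>n\<^sup>2 / 2)) \<le> 1 / sqrt (1 - a)\<close> for all \<open>0 \<le> a < 1\<close>, a bound that does not depend on \<open>n\<close>.
  Hence \<open>f (S\<^sub>n)\<close> is bounded in \<open>L\<^sup>p\<close> for some \<open>p > 1\<close>, so cutting \<open>f\<close> off at a high level changes the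
  expectations by little, uniformly in \<open>n\<close>, and the central limit theorem applies to the
  truncated function.
\<close>

section \<open>Gaussian integrals and exponential moments of squares\<close>

lemma nn_integral_exp_linear_std_normal:
  "(\<integral>\<^sup>+z. ennreal (exp (c * z)) \<partial>std_normal_distribution) = ennreal (exp (c\<^sup>2 / 2))"
proof -
  \<comment> \<open>Completing the square:
    \<open>c * z - z\<^sup>2 / 2 = c\<^sup>2 / 2 - (z - c)\<^sup>2 / 2\<close>, so exponential
    tilting only moves the mean to \<open>c\<close>.\<close>
  have *: "std_normal_density z * exp (c * z) = exp (c\<^sup>2 / 2) * normal_density c 1 z" for z
    by (simp add: normal_density_def mult_exp_exp power2_eq_square field_simps)
  have "(\<integral>\<^sup>+z. ennreal (exp (c * z)) \<partial>std_normal_distribution) =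
      (\<integral>\<^sup>+z. ennreal (exp (c\<^sup>2 / 2)) * ennreal (normal_density c 1 z) \<partial>lborel)"
    by (subst nn_integral_density) (auto simp: * simp flip: ennreal_mult')
  also have "\<dots> = ennreal (exp (c\<^sup>2 / 2)) * (\<integral>\<^sup>+z. ennreal (normal_density c 1 z) \<partial>lborel)"
    by (rule nn_integral_cmult) auto
  also have "(\<integral>\<^sup>+z. ennreal (normal_density c 1 z) \<partial>lborel) = 1"
    using prob_space.emeasure_space_1[OF prob_space_normal_density[of 1 c]]
    by (simp add: emeasure_density)
  finally show ?thesis by simp
qed

lemma nn_integral_exp_square_std_normal:
  assumes "a < 1"
  shows "(\<integral>\<^sup>+z. ennreal (exp (a * z\<^sup>2 / 2)) \<partial>std_normal_distribution) = ennreal (1 / sqrt (1 - a))"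
proof -
  \<comment> \<open>The tilted exponent is \<open>- (1 - a) * z\<^sup>2 / 2\<close>, that of a
    centred normal law of variance \<open>1 / (1 - a)\<close>; the ratio of the normalizing
    constants is \<sigma>.\<close>
  define \<sigma> where "\<sigma> = 1 / sqrt (1 - a)"
  have \<sigma>: "\<sigma> > 0" "1 / \<sigma>\<^sup>2 = 1 - a"
    using assms by (auto simp: \<sigma>_def power_divide)
  have *: "std_normal_density z * exp (a * z\<^sup>2 / 2) = \<sigma> * normal_density 0 \<sigma> z" for z
  proof -
    have "std_normal_density z * exp (a * z\<^sup>2 / 2) =
        1 / sqrt (2 * pi) * exp (- z\<^sup>2 / 2 * (1 - a))"
      by (simp add: normal_density_def mult_exp_exp field_simps)
    also have "\<dots> = \<sigma> * normal_density 0 \<sigma> z"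
      using \<sigma>(1) unfolding \<sigma>(2)[symmetric] by (simp add: normal_density_def real_sqrt_mult)
    finally show ?thesis .
  qed
  have "(\<integral>\<^sup>+z. ennreal (exp (a * z\<^sup>2 / 2)) \<partial>std_normal_distribution) =
      (\<integral>\<^sup>+z. ennreal \<sigma> * ennreal (normal_density 0 \<sigma> z) \<partial>lborel)"
    using \<sigma>(1) by (subst nn_integral_density) (auto simp: * simp flip: ennreal_mult')
  also have "\<dots> = ennreal \<sigma> * (\<integral>\<^sup>+z. ennreal (normal_density 0 \<sigma> z) \<partial>lborel)"
    by (rule nn_integral_cmult) auto
  also have "(\<integral>\<^sup>+z. ennreal (normal_density 0 \<sigma> z) \<partial>lborel) = 1"
    using prob_space.emeasure_space_1[OF prob_space_normal_density[OF \<sigma>(1), of 0]]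
    by (simp add: emeasure_density)
  finally show ?thesis by (simp add: \<sigma>_def)
qed

text \<open>The square is linearized by an auxiliary Gaussian integral with
  \<open>c = sqrt a * W x\<close>. All integrands are nonnegative, so the exchange of integrals
  needs no integrability and finiteness comes out as a result.\<close>

lemma (in prob_space) subgaussian_exp_square:
  assumes [measurable]: "W \<in> borel_measurable M"
    and mgf: "\<And>t. (\<integral>\<^sup>+x. ennreal (exp (t * W x)) \<partial>M) \<le> ennreal (exp (t\<^sup>2 / 2))"
    and a: "0 \<le> a" "a < 1"
  shows "(\<integral>\<^sup>+x. ennreal (exp (a * (W x)\<^sup>2 / 2)) \<partial>M) \<le> ennreal (1 / sqrt (1 - a))"
proof -
  interpret N: prob_space std_normal_distribution
    by (rule prob_space_normal_density) simp
  interpret P: pair_sigma_finite std_normal_distribution M ..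
  have "(\<integral>\<^sup>+x. ennreal (exp (a * (W x)\<^sup>2 / 2)) \<partial>M) =
      (\<integral>\<^sup>+x. (\<integral>\<^sup>+z. ennreal (exp ((sqrt a * W x) * z)) \<partial>std_normal_distribution) \<partial>M)"
    using a by (simp add: nn_integral_exp_linear_std_normal power_mult_distrib)
  also have "\<dots> = (\<integral>\<^sup>+z. (\<integral>\<^sup>+x. ennreal (exp ((sqrt a * W x) * z)) \<partial>M) \<partial>std_normal_distribution)"
    by (rule P.Fubini') measurable
  also have "\<dots> \<le> (\<integral>\<^sup>+z. ennreal (exp (a * z\<^sup>2 / 2)) \<partial>std_normal_distribution)"
  proof (rule nn_integral_mono)
    fix z
    show "(\<integral>\<^sup>+x. ennreal (exp ((sqrt a * W x) * z)) \<partial>M) \<le> ennreal (exp (a * z\<^sup>2 / 2))"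
      using mgf[of "sqrt a * z"] a by (simp add: power_mult_distrib mult_ac)
  qed
  also have "\<dots> = ennreal (1 / sqrt (1 - a))"
    by (rule nn_integral_exp_square_std_normal) fact
  finally show ?thesis .
qed

section \<open>Moment generating functions of bounded independent sums\<close>

lemma (in interval_bounded_random_variable) Hoeffdings_lemma_nn_integral_all:
  "(\<integral>\<^sup>+x. ennreal (exp (l * (f x - expectation f))) \<partial>M) \<le> ennreal (exp (l\<^sup>2 * (b - a)\<^sup>2 / 8))"
proof (cases l "0 :: real" rule: linorder_cases)
  case less
  \<comment> \<open>Reflection: \<open>- f\<close> lies in an interval of the same length, so a
    negative \<open>l\<close> for \<open>f\<close> is a positive one for \<open>- f\<close>. Both
    signs matter because the Gaussian averaging variable takes both.\<close>
  interpret neg: interval_bounded_random_variable M "\<lambda>x. - f x" "- b" "- a"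
    by unfold_locales (auto intro!: eventually_mono[OF AE_in_interval])
  show ?thesis
    using neg.Hoeffdings_lemma_nn_integral[of "- l"] less
    by (simp add: algebra_simps)
next
  case equal
  then show ?thesis by (simp add: emeasure_space_1)
next
  case greater
  then show ?thesis by (rule Hoeffdings_lemma_nn_integral)
qed

lemma (in indep_interval_bounded_random_variables) mgf_sum_le:
  "(\<integral>\<^sup>+x. ennreal (exp (l * (\<Sum>i\<in>I. X i x - expectation (X i)))) \<partial>M)
     \<le> ennreal (exp (l\<^sup>2 * (\<Sum>i\<in>I. (b i - a i)\<^sup>2) / 8))"
proof -
  have "(\<integral>\<^sup>+x. ennreal (exp (l * (\<Sum>i\<in>I. X i x - expectation (X i)))) \<partial>M) =
      (\<integral>\<^sup>+x. (\<Prod>i\<in>I. ennreal (exp (l * (X i x - expectation (X i))))) \<partial>M)"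
    by (simp add: sum_distrib_left exp_sum fin prod_ennreal)
  also have "\<dots> = (\<Prod>i\<in>I. \<integral>\<^sup>+x. ennreal (exp (l * (X i x - expectation (X i)))) \<partial>M)"
    by (intro indep_vars_nn_integral fin indep_vars_compose2[OF indep]) auto
  also have "\<dots> \<le> (\<Prod>i\<in>I. ennreal (exp (l\<^sup>2 * (b i - a i)\<^sup>2 / 8)))"
  proof (rule prod_mono_ennreal)
    fix i assume "i \<in> I"
    then interpret interval_bounded_random_variable M "X i" "a i" "b i" ..
    show "(\<integral>\<^sup>+x. ennreal (exp (l * (X i x - expectation (X i)))) \<partial>M)
        \<le> ennreal (exp (l\<^sup>2 * (b i - a i)\<^sup>2 / 8))"
      by (rule Hoeffdings_lemma_nn_integral_all)
  qed
  also have "\<dots> = ennreal (exp (l\<^sup>2 * (\<Sum>i\<in>I. (b i - a i)\<^sup>2) / 8))"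
    by (simp add: prod_ennreal exp_sum fin sum_distrib_left sum_divide_distrib)
  finally show ?thesis .
qed

section \<open>Truncation and passage to the limit\<close>

lemma truncation_error_le:
  fixes y g L p :: real
  assumes "\<bar>y\<bar> \<le> exp g" "1 < p"
  shows "\<bar>y - max (- exp L) (min (exp L) y)\<bar> \<le> exp (- ((p - 1) * L)) * exp (p * g)"
proof (cases "\<bar>y\<bar> \<le> exp L")
  case True
  then have "max (- exp L) (min (exp L) y) = y" by (auto simp: max_def min_def)
  then show ?thesis by simp
next
  case False
  with assms(1) have "exp L < exp g" by linarith
  \<comment> \<open>As in Markov's inequality: an error occurs only where \<open>g > L\<close>, and
    there the surplus \<open>(p - 1) * (g - L)\<close> in the exponent pays for a factor that decays
    in \<open>L\<close>.\<close>
  then have "0 \<le> (p - 1) * (g - L)" using assms(2) by simp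
  then have "g \<le> - ((p - 1) * L) + p * g" by (simp add: algebra_simps)
  have "\<bar>y - max (- exp L) (min (exp L) y)\<bar> \<le> \<bar>y\<bar>"
    using exp_gt_zero[of L] by linarith
  also have "\<dots> \<le> exp g" by fact
  also have "\<dots> \<le> exp (- ((p - 1) * L) + p * g)" using \<open>g \<le> _\<close> by simp
  finally show ?thesis by (simp only: exp_add)
qed

text \<open>The bound depends on the measure only through \<open>C\<close>, so one level
  \<open>L\<close> can serve a whole family of laws. Integrability of \<open>f\<close> is derived:
  it is its bounded truncation plus a dominated difference.\<close>

lemma (in prob_space) expectation_truncation_error_le:
  assumes [measurable]: "f \<in> borel_measurable M" "g \<in> borel_measurable M"
    and fg: "\<And>x. \<bar>f x\<bar> \<le> exp (g x)" and p: "1 < p"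
    and C: "(\<integral>\<^sup>+x. ennreal (exp (p * g x)) \<partial>M) \<le> ennreal C" "0 \<le> C"
  shows "\<bar>expectation f - expectation (\<lambda>x. max (- exp L) (min (exp L) (f x)))\<bar>
           \<le> exp (- ((p - 1) * L)) * C"
proof -
  let ?f = "\<lambda>x. max (- exp L) (min (exp L) (f x))"
  have int_exp: "integrable M (\<lambda>x. exp (p * g x))"
    using C by (intro integrableI_bounded) (auto simp: le_less_trans)
  have le: "\<bar>f x - ?f x\<bar> \<le> exp (- ((p - 1) * L)) * exp (p * g x)" for x
    using fg p by (rule truncation_error_le)
  have int_trunc: "integrable M ?f"
    by (rule integrable_const_bound[where B = "exp L"]) (auto simp: max_def min_def)
  have int_diff: "integrable M (\<lambda>x. f x - ?f x)"
    by (rule Bochner_Integration.integrable_bound[OF integrable_mult_right[OF int_exp, of "exp (- ((p - 1) * L))"]])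
       (use le in auto)
  have "integrable M f"
    using Bochner_Integration.integrable_add[OF int_diff int_trunc] by simp
  then have "\<bar>expectation f - expectation ?f\<bar> = \<bar>expectation (\<lambda>x. f x - ?f x)\<bar>"
    using int_trunc by simp
  also have "\<dots> \<le> expectation (\<lambda>x. \<bar>f x - ?f x\<bar>)"
    by (rule integral_abs_bound)
  also have "\<dots> \<le> expectation (\<lambda>x. exp (- ((p - 1) * L)) * exp (p * g x))"
    using int_diff int_exp le by (intro integral_mono) auto
  also have "\<dots> = exp (- ((p - 1) * L)) * expectation (\<lambda>x. exp (p * g x))"
    by simp
  also have "\<dots> \<le> exp (- ((p - 1) * L)) * C"
  proof (intro mult_left_mono)
    show "expectation (\<lambda>x. exp (p * g x)) \<le> C"
      using C by (subst integral_eq_nn_integral) (auto intro!: enn2real_leI)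
  qed simp
  finally show ?thesis .
qed

text \<open>A quantitative form of uniform integrability: the common moment bound \<open>C\<close>
  lets weak convergence reach an unbounded \<open>f\<close>. The error splits into three parts below
  \<open>r / 3\<close>: truncation under \<open>\<mu> n\<close>, weak convergence, truncation under
  \<nu>.\<close>

lemma weak_conv_imp_integral_conv_bounded_exp_moment:
  fixes f g :: "real \<Rightarrow> real"
  assumes \<mu>: "\<And>n. real_distribution (\<mu> n)" and \<nu>: "real_distribution \<nu>"
    and conv: "weak_conv_m \<mu> \<nu>"
    and cont: "continuous_on UNIV f" and g: "g \<in> borel_measurable borel"
    and fg: "\<And>x. \<bar>f x\<bar> \<le> exp (g x)" and p: "1 < p"
    and C\<mu>: "\<And>n. (\<integral>\<^sup>+x. ennreal (exp (p * g x)) \<partial>\<mu> n) \<le> ennreal C"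
    and C\<nu>: "(\<integral>\<^sup>+x. ennreal (exp (p * g x)) \<partial>\<nu>) \<le> ennreal C" and C: "0 \<le> C"
  shows "(\<lambda>n. integral\<^sup>L (\<mu> n) f) \<longlonglongrightarrow> integral\<^sup>L \<nu> f"
proof (rule LIMSEQ_I)
  fix r :: real assume "0 < r"
  have f: "f \<in> borel_measurable borel"
    using cont by (rule borel_measurable_continuous_onI)
  have err: "\<bar>integral\<^sup>L K f - integral\<^sup>L K (\<lambda>x. max (- exp L) (min (exp L) (f x)))\<bar>
      \<le> exp (- ((p - 1) * L)) * C"
    if "real_distribution K" "(\<integral>\<^sup>+x. ennreal (exp (p * g x)) \<partial>K) \<le> ennreal C" for K L
  proof -
    interpret real_distribution K by fact
    show ?thesis
      using f g fg p that(2) C by (intro expectation_truncation_error_le) simp_all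
  qed
  have "((\<lambda>L. exp (- ((p - 1) * L)) * C) \<longlongrightarrow> 0 * C) at_top"
    using p by (intro tendsto_mult tendsto_const filterlim_compose[OF exp_at_bot]
        filterlim_compose[OF filterlim_uminus_at_bot_at_top]
        filterlim_tendsto_pos_mult_at_top[OF tendsto_const] filterlim_ident) simp
  then have "eventually (\<lambda>L. exp (- ((p - 1) * L)) * C < r / 3) at_top"
    using \<open>0 < r\<close> by (intro order_tendstoD(2)) auto
  \<comment> \<open>The level is fixed before \<open>n0\<close>; the truncated function must not
    vary with \<open>n\<close> when weak convergence is applied to it.\<close>
  then obtain L where L: "exp (- ((p - 1) * L)) * C < r / 3"
    by (auto dest: eventually_happens)
  let ?f = "\<lambda>x. max (- exp L) (min (exp L) (f x))"
  have "(\<lambda>n. integral\<^sup>L (\<mu> n) ?f) \<longlonglongrightarrow> integral\<^sup>L \<nu> ?f"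
  proof (rule weak_conv_imp_integral_bdd_continuous_conv[OF \<mu> \<nu> conv])
    show "isCont ?f x" for x
      using cont by (intro continuous_intros) (simp add: continuous_on_eq_continuous_at)
    show "norm (?f x) \<le> exp L" for x by (auto simp: max_def min_def)
  qed
  then obtain n0 where n0: "\<And>n. n \<ge> n0 \<Longrightarrow> norm (integral\<^sup>L (\<mu> n) ?f - integral\<^sup>L \<nu> ?f) < r / 3"
    using \<open>0 < r\<close> by (meson LIMSEQ_D divide_pos_pos zero_less_numeral)
  show "\<exists>n0. \<forall>n\<ge>n0. norm (integral\<^sup>L (\<mu> n) f - integral\<^sup>L \<nu> f) < r"
  proof (intro exI allI impI)
    fix n assume "n \<ge> n0"
    from n0[OF this] err[OF \<mu> C\<mu>, of n L] err[OF \<nu> C\<nu>, of L] L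
    show "norm (integral\<^sup>L (\<mu> n) f - integral\<^sup>L \<nu> f) < r"
      unfolding real_norm_def by linarith
  qed
qed

section \<open>Reindexing independent families, and variables with two equally likely values\<close>

lemma (in prob_space) indep_sets_reindex_inj:
  assumes indep: "indep_sets F (h ` I)" and inj: "inj_on h I"
  shows "indep_sets (\<lambda>i. F (h i)) I"
proof (rule indep_setsI)
  fix A J assume J: "J \<noteq> {}" "J \<subseteq> I" "finite J" and A: "\<forall>j\<in>J. A j \<in> F (h j)"
  define B where "B k = A (the_inv_into I h k)" for k
  have B: "B (h j) = A j" if "j \<in> J" for j
    using that J inj by (auto simp: B_def the_inv_into_f_f)
  have "prob (\<Inter>k\<in>h ` J. B k) = (\<Prod>k\<in>h ` J. prob (B k))"
    using J A B by (intro indep_setsD[OF indep]) auto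
  also have "\<dots> = (\<Prod>j\<in>J. prob (A j))"
    using B inj_on_subset[OF inj J(2)] by (simp add: prod.reindex)
  finally show "prob (\<Inter>j\<in>J. A j) = (\<Prod>j\<in>J. prob (A j))"
    using B by simp
qed (use indep in \<open>auto simp: indep_sets_def\<close>)

lemma (in prob_space) indep_vars_reindex_inj:
  assumes "indep_vars M' X (h ` I)" "inj_on h I"
  shows "indep_vars (\<lambda>i. M' (h i)) (\<lambda>i. X (h i)) I"
  using assms unfolding indep_vars_def2 by (auto intro: indep_sets_reindex_inj)

lemma (in prob_space) AE_two_values:
  fixes X :: "'a \<Rightarrow> real"
  assumes [measurable]: "X \<in> borel_measurable M" and "c \<noteq> d"
    and c: "prob {x \<in> space M. X x = c} = 1 / 2" and d: "prob {x \<in> space M. X x = d} = 1 / 2"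
  shows "AE x in M. X x = c \<or> X x = d"
proof -
  have "prob {x \<in> space M. X x = c \<or> X x = d} =
      prob ({x \<in> space M. X x = c} \<union> {x \<in> space M. X x = d})"
    by (rule arg_cong[where f = prob]) auto
  also have "\<dots> = 1"
    using \<open>c \<noteq> d\<close> by (subst finite_measure_Union) (auto simp: c d)
  finally show ?thesis by (simp add: prob_Collect_eq_1)
qed

text \<open>Serves both for the mean, with \<open>h\<close> the identity, and for the variance, with
  \<open>h\<close> the squared distance to \<open>1 / 2\<close>.\<close>

lemma (in prob_space) expectation_two_values:
  fixes X :: "'a \<Rightarrow> real" and h :: "real \<Rightarrow> real"
  assumes [measurable]: "X \<in> borel_measurable M" "h \<in> borel_measurable borel" and "c \<noteq> d"
    and c: "prob {x \<in> space M. X x = c} = 1 / 2" and d: "prob {x \<in> space M. X x = d} = 1 / 2"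
  shows "expectation (\<lambda>x. h (X x)) = (h c + h d) / 2"
proof -
  have "expectation (\<lambda>x. h (X x)) = expectation (\<lambda>x.
      h c * indicator {x \<in> space M. X x = c} x + h d * indicator {x \<in> space M. X x = d} x)"
    using AE_two_values[OF assms(1) \<open>c \<noteq> d\<close> c d] \<open>c \<noteq> d\<close> AE_space
    by (intro integral_cong_AE) (auto elim!: eventually_rev_mp simp: indicator_def)
  also have "\<dots> = (h c + h d) / 2"
  proof -
    have "integrable M (\<lambda>x. h e * indicator {x \<in> space M. X x = e} x)" for e
      by (rule integrable_const_bound[where B = "\<bar>h e\<bar>"]) (auto simp: indicator_def)
    then show ?thesis by (simp add: c d add_divide_distrib)
  qed
  finally show ?thesis .
qed

theorem theorem5p10:
  fixes M :: "'a measure" and X :: "nat \<Rightarrow> 'a \<Rightarrow> real"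
    and N :: "'b measure" and Y :: "'b \<Rightarrow> real"
    and f :: "real \<Rightarrow> real"
  assumes "prob_space M"
    and "prob_space.indep_vars M (\<lambda>_. borel) X {1..}"
    and "\<And>i j. i \<ge> 1 \<Longrightarrow> j \<ge> 1 \<Longrightarrow> distr M borel (X i) = distr M borel (X j)"
    and "\<And>k. k \<ge> 1 \<Longrightarrow> measure M {\<omega> \<in> space M. X k \<omega> = 0} = 1 / 2"
    and "\<And>k. k \<ge> 1 \<Longrightarrow> measure M {\<omega> \<in> space M. X k \<omega> = 1} = 1 / 2"
    and "prob_space N"
    and "distributed N lborel Y std_normal_density"
    and "continuous_on UNIV f"
    and "integrable std_normal_distribution f"
    and "\<exists>\<epsilon>. 0 < \<epsilon> \<and> \<epsilon> < 1 / 2 \<and> (\<forall>x. \<bar>f x\<bar> \<le> exp ((1 / 2 - \<epsilon>) * x\<^sup>2))"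
  shows "(\<lambda>n. integral\<^sup>L M (\<lambda>\<omega>. f (S X n \<omega>))) \<longlonglongrightarrow> integral\<^sup>L N (\<lambda>\<omega>. f (Y \<omega>))"
proof -
  interpret M: prob_space M by fact
  interpret N: real_distribution std_normal_distribution by (rule real_dist_normal_dist)
  \<comment> \<open>The shift gives a sequence indexed by all naturals, as the central limit theorem
    expects, and leaves out \<open>X 0\<close>, about which nothing is assumed.\<close>
  define X' where "X' = (\<lambda>i. X (Suc i))"
  have rv [measurable]: "X' i \<in> borel_measurable M" for i
    using assms(2) unfolding M.indep_vars_def X'_def by auto
  have P0: "M.prob {x \<in> space M. X' i x = 0} = 1 / 2"
    and P1: "M.prob {x \<in> space M. X' i x = 1} = 1 / 2" for i
    using assms(4,5)[of "Suc i"] by (simp_all add: X'_def)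
  note expect = M.expectation_two_values[OF rv _ zero_neq_one P0 P1]
  have mean: "M.expectation (X' i) = 1 / 2" for i
    using expect[of "\<lambda>x. x" i] by simp
  have indep: "M.indep_vars (\<lambda>_. borel) X' UNIV"
    unfolding X'_def
    by (rule M.indep_vars_reindex_inj[OF M.indep_vars_subset[OF assms(2)]]) auto
  have AE01: "AE x in M. X' i x = 0 \<or> X' i x = 1" for i
    by (rule M.AE_two_values[OF rv zero_neq_one P0 P1])

  have S_eq: "S X n x = (\<Sum>i<n. X' i x - 1 / 2) / (sqrt n / 2)" for n x
  proof -
    have "(\<Sum>k = 1..n. X k x) = (\<Sum>i<n. X' i x)"
      unfolding X'_def by (rule sum.reindex_bij_witness[of _ Suc "\<lambda>k. k - 1"]) auto
    then show ?thesis by (simp add: S_def sum_subtractf)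
  qed
  have rv_S [measurable]: "S X n \<in> borel_measurable M" for n
    unfolding S_eq[abs_def] by measurable

  \<comment> \<open>Each variable has standard deviation \<open>1 / 2\<close>, so the normalizer
    \<open>sqrt (n * (1 / 2)\<^sup>2)\<close> is the \<open>sqrt n / 2\<close> in
    \<open>S\<close>.\<close>
  have clt: "weak_conv_m (\<lambda>n. distr M borel (S X n)) std_normal_distribution"
  proof -
    have "weak_conv_m (\<lambda>n. distr M borel
        (\<lambda>x. (\<Sum>i<n. X' i x - 1 / 2) / sqrt (n * (1 / 2)\<^sup>2))) std_normal_distribution"
    proof (rule M.central_limit_theorem[OF indep mean])
      show "integrable M (\<lambda>x. (X' i x)\<^sup>2)" for i
        by (rule M.integrable_const_bound[where B = 1])
           (use AE01[of i] in \<open>auto elim!: eventually_mono\<close>)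
      show "M.variance (X' i) = (1 / 2)\<^sup>2" for i
        unfolding mean using expect[of "\<lambda>x. (x - 1 / 2)\<^sup>2" i] by (simp add: power2_eq_square)
      show "distr M borel (X' i) = distr M borel (X 1)" for i
        unfolding X'_def by (rule assms(3)) auto
    qed simp
    then show ?thesis
      by (simp add: S_eq[abs_def] real_sqrt_mult real_sqrt_divide power_divide)
  qed

  have subgaussian: "(\<integral>\<^sup>+x. ennreal (exp (t * S X n x)) \<partial>M) \<le> ennreal (exp (t\<^sup>2 / 2))" for n t
  proof (cases "n = 0")
    \<comment> \<open>Division by zero gives \<open>S X 0 x = 0\<close>, so the integral is 1 and
      the bound holds for every \<open>n\<close>.\<close>
    case True
    then show ?thesis by (simp add: S_def M.emeasure_space_1)
  next
    case False
    interpret indep_interval_bounded_random_variables M "{..<n}" X' "\<lambda>_. 0" "\<lambda>_. 1"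
    proof
      show "M.indep_vars (\<lambda>_. borel) X' {..<n}"
        by (rule M.indep_vars_subset[OF indep]) simp
      show "AE x in M. X' i x \<in> {0..1}" for i
        using AE01[of i] by eventually_elim auto
    qed simp
    \<comment> \<open>Dividing by \<open>sqrt n / 2\<close> turns \<open>t\<close> into
      \<open>2 * t / sqrt n\<close>; with \<open>n\<close> intervals of length 1 the dependence on
      \<open>n\<close> cancels exactly.\<close>
    have "(2 * t / sqrt n)\<^sup>2 * (\<Sum>i<n. (1 - 0)\<^sup>2) / 8 = t\<^sup>2 / 2"
      using False by (simp add: power_divide power_mult_distrib)
    moreover have "t * S X n x = 2 * t / sqrt n * (\<Sum>i<n. X' i x - 1 / 2)" for x
      by (simp add: S_eq)
    ultimately show ?thesis
      using mgf_sum_le[of "2 * t / sqrt n"] by (simp only: mean)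
  qed

  obtain \<epsilon> where \<epsilon>: "0 < \<epsilon>" "\<epsilon> < 1 / 2"
    and f_le: "\<And>x. \<bar>f x\<bar> \<le> exp ((1 / 2 - \<epsilon>) * x\<^sup>2)"
    using assms(10) by blast
  \<comment> \<open>Chosen so that \<open>p * (1 / 2 - \<epsilon>) = (1 - \<epsilon>) / 2\<close>:
    the exponential moment bound then applies with \<open>a = 1 - \<epsilon>\<close> and yields the
    constant \<open>1 / sqrt \<epsilon>\<close>, for the sums and the normal law alike.\<close>
  define p where "p = (1 - \<epsilon>) / (1 - 2 * \<epsilon>)"
  have p: "1 < p" and p_exp: "p * ((1 / 2 - \<epsilon>) * x\<^sup>2) = (1 - \<epsilon>) * x\<^sup>2 / 2" for x
    using \<epsilon> by (auto simp: p_def divide_simps)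

  have "(\<lambda>n. integral\<^sup>L (distr M borel (S X n)) f) \<longlonglongrightarrow> integral\<^sup>L std_normal_distribution f"
  proof (rule weak_conv_imp_integral_conv_bounded_exp_moment[OF _ N.real_distribution_axioms clt
        assms(8) _ f_le p, where C = "1 / sqrt \<epsilon>"])
    show "real_distribution (distr M borel (S X n))" for n
      by (rule M.real_distribution_distr) (rule rv_S)
    show "(\<integral>\<^sup>+x. ennreal (exp (p * ((1 / 2 - \<epsilon>) * x\<^sup>2))) \<partial>distr M borel (S X n))
        \<le> ennreal (1 / sqrt \<epsilon>)" for n
      using M.subgaussian_exp_square[OF rv_S subgaussian, of "1 - \<epsilon>" n] \<epsilon>
      unfolding p_exp by (subst nn_integral_distr) auto
    show "(\<integral>\<^sup>+x. ennreal (exp (p * ((1 / 2 - \<epsilon>) * x\<^sup>2))) \<partial>std_normal_distribution)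
        \<le> ennreal (1 / sqrt \<epsilon>)"
      using nn_integral_exp_square_std_normal[of "1 - \<epsilon>"] \<epsilon> unfolding p_exp by simp
  qed (use \<epsilon> in auto)
  moreover have f: "f \<in> borel_measurable borel"
    using assms(8) by (rule borel_measurable_continuous_onI)
  then have "integral\<^sup>L (distr M borel (S X n)) f = M.expectation (\<lambda>\<omega>. f (S X n \<omega>))" for n
    by (intro integral_distr) auto
  moreover have "integral\<^sup>L std_normal_distribution f = integral\<^sup>L N (\<lambda>\<omega>. f (Y \<omega>))"
    unfolding distributed_distr_eq_density[OF assms(7), symmetric]
    using f distributed_measurable[OF assms(7)] by (intro integral_distr) auto
  ultimately show ?thesis by simp
qed

end
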